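(* Let $k\ge 1$. In the game described in the context (starting from the empty board), Builder has a strategy such that, against every strategy of Painter, at least one of the following occurs: a red $P_3$ or a blue $P_3$ appears within the first $6k-3$ rounds; or after at most $6k-4$ rounds the board contains a bad green $P_{4k-2}$; or after at most $6k-3$ rounds the board contains a good green $P_{4k-2}$.
   Context: $P_m$ denotes the path on $m$ vertices. Game: Builder and Painter play on an infinite vertex set, initially with no edges; in each round Builder draws an edge between two nonadjacent vertices and Painter immediately colors it red, blue or green. A green path is a path all of whose edges are green. A green path is called good if at least one of its endpoints is incident to a red or blue edge, and bad otherwise. *)

theory Defs
  imports Main
begin

datatype colour = Red | Blue | Green

text \<open>A position of the game is the chronological list of the edges drawn so far,
  each with the colour it received. An edge is a two-element set of vertices.\<close>

type_synonym 'v position = "('v set \<times> colour) list"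

definition legal_edge :: "'v set \<Rightarrow> 'v position \<Rightarrow> 'v set \<Rightarrow> bool" where
  "legal_edge V h e \<longleftrightarrow>
     (\<exists>u\<in>V. \<exists>v\<in>V. u \<noteq> v \<and> e = {u, v}) \<and> e \<notin> fst ` set h"

definition legal_position :: "'v set \<Rightarrow> 'v position \<Rightarrow> bool" where
  "legal_position V h \<longleftrightarrow> (\<forall>i<length h. legal_edge V (take i h) (fst (h ! i)))"

type_synonym 'v builder = "'v position \<Rightarrow> 'v set"

type_synonym 'v painter = "'v position \<Rightarrow> 'v set \<Rightarrow> colour"

definition builder_strategy :: "'v set \<Rightarrow> 'v builder \<Rightarrow> bool" where
  "builder_strategy V \<beta> \<longleftrightarrow> (\<forall>h. legal_position V h \<longrightarrow> legal_edge V h (\<beta> h))"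

text \<open>The position after \<open>n\<close> rounds, starting from the empty board.\<close>

primrec play :: "'v builder \<Rightarrow> 'v painter \<Rightarrow> nat \<Rightarrow> 'v position" where
  "play \<beta> \<pi> 0 = []"
| "play \<beta> \<pi> (Suc n) =
     (let h = play \<beta> \<pi> n; e = \<beta> h in h @ [(e, \<pi> h e)])"

text \<open>A path is given by its list of vertices, so a copy of \<open>P\<^sub>m\<close> is a list of length \<open>m\<close>.\<close>

definition mono_path :: "'v position \<Rightarrow> colour \<Rightarrow> 'v list \<Rightarrow> bool" where
  "mono_path h c p \<longleftrightarrow> p \<noteq> [] \<and> distinct p \<and>
     (\<forall>i. Suc i < length p \<longrightarrow> ({p ! i, p ! Suc i}, c) \<in> set h)"

definition contains_mono_path :: "'v position \<Rightarrow> colour \<Rightarrow> nat \<Rightarrow> bool" where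
  "contains_mono_path h c m \<longleftrightarrow> (\<exists>p. mono_path h c p \<and> length p = m)"

definition touches_red_blue :: "'v position \<Rightarrow> 'v \<Rightarrow> bool" where
  "touches_red_blue h v \<longleftrightarrow> (\<exists>e. v \<in> e \<and> ((e, Red) \<in> set h \<or> (e, Blue) \<in> set h))"

definition good_green_path :: "'v position \<Rightarrow> 'v list \<Rightarrow> bool" where
  "good_green_path h p \<longleftrightarrow>
     mono_path h Green p \<and> (touches_red_blue h (hd p) \<or> touches_red_blue h (last p))"

definition bad_green_path :: "'v position \<Rightarrow> 'v list \<Rightarrow> bool" where
  "bad_green_path h p \<longleftrightarrow> mono_path h Green p \<and> \<not> good_green_path h p"

end

theory Submission
  imports Defs
begin

text \<open>
  Induct on \<open>k\<close>: a green path is prolonged by four vertices in six rounds if one of its ends already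
  touches a red or blue edge, and in seven rounds otherwise. In the second case Builder joins an end
  to fresh vertices; either all four edges become green, which leaves three rounds to spare, or the
  first non-green edge makes the path good at the cost of a single round. In the first case Painter
  cannot colour an edge at the touched end with the colour seen there without creating a red or blue
  \<open>P\<^sub>3\<close>, and a finite case analysis, recorded as an explicit strategy tree, shows that \<open>n \<le> 4\<close> further
  vertices can be had in \<open>n + 2\<close> rounds, or in \<open>n + 1\<close> if the resulting path is bad. The trees do not
  depend on the length of the path, because only its two ends and fresh vertices are used.
\<close>

section \<open>Forcing\<close>

text \<open>The least such predicate admits only well-founded game trees: Builder meets
  \<open>Q\<close> after finitely many rounds, whatever the colours.\<close>

inductive forces :: "'v set \<Rightarrow> ('v position \<Rightarrow> bool) \<Rightarrow> 'v position \<Rightarrow> bool" for V Q where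
  reached: "Q h \<Longrightarrow> forces V Q h"
| draw: "legal_edge V h e \<Longrightarrow> (\<And>c. forces V Q (h @ [(e, c)])) \<Longrightarrow> forces V Q h"

lemma legal_position_Nil [simp]: "legal_position V []"
  by (simp add: legal_position_def)

lemma legal_position_snoc [simp]:
  "legal_position V (h @ [(e, c)]) \<longleftrightarrow> legal_position V h \<and> legal_edge V h e"
  by (auto simp: legal_position_def less_Suc_eq nth_append)

lemma legal_position_edge:
  assumes "legal_position V h" and "(e, c) \<in> set h"
  obtains u v where "u \<in> V" "v \<in> V" "u \<noteq> v" "e = {u, v}"
proof -
  obtain i where "i < length h" "h ! i = (e, c)"
    using assms(2) by (meson in_set_conv_nth)
  then have "legal_edge V (take i h) e"
    using assms(1) unfolding legal_position_def by (metis fst_conv)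
  then show thesis
    using that unfolding legal_edge_def by blast
qed

lemma finite_vertices:
  assumes "legal_position V h"
  shows "finite (\<Union>(fst ` set h))"
proof (rule finite_Union)
  fix e assume "e \<in> fst ` set h"
  then obtain c where "(e, c) \<in> set h" by auto
  then show "finite e" by (metis assms finite.emptyI finite.insertI legal_position_edge)
qed simp

lemma fresh_vertex:
  assumes "infinite V" and "legal_position V h" and "finite A"
  obtains x where "x \<in> V" "x \<notin> A" "x \<notin> \<Union>(fst ` set h)"
proof -
  have "infinite (V - (A \<union> \<Union>(fst ` set h)))"
    using assms finite_vertices[OF assms(2)] by (intro Diff_infinite_finite) auto
  then obtain x where "x \<in> V - (A \<union> \<Union>(fst ` set h))"
    by (metis finite.emptyI ex_in_conv)
  then show thesis using that by blast
qed

lemma legal_edge_fresh: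
  assumes "u \<in> V" "x \<in> V" "x \<noteq> u" "x \<notin> \<Union>(fst ` set h)"
  shows "legal_edge V h {u, x}"
  using assms unfolding legal_edge_def by blast

text \<open>Grafts a second strategy onto the leaves of the first. Legality is carried along because
  later stages need it to find fresh vertices.\<close>

lemma forces_bind:
  assumes "forces V Q h" and "legal_position V h"
    and "\<And>h. legal_position V h \<Longrightarrow> Q h \<Longrightarrow> forces V Q' h"
  shows "forces V Q' h"
  using assms(1,2)
proof (induction rule: forces.induct)
  case (reached h)
  then show ?case using assms(3) by blast
next
  case (draw h e)
  then show ?case by (auto intro: forces.draw[of V h e])
qed

text \<open>Some branch ends in a leaf with \<open>Q\<close>, and positions only grow along
  it.\<close>

lemma forces_length:
  assumes "forces V Q h" and "\<And>h. Q h \<Longrightarrow> length h \<le> T"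
  shows "length h \<le> T"
  using assms(1)
proof (induction rule: forces.induct)
  case (reached h)
  then show ?case by (rule assms(2))
next
  case (draw h e)
  then show ?case by simp
qed

lemma length_play [simp]: "length (play \<beta> \<pi> n) = n"
  by (induction n) (simp_all add: Let_def)

text \<open>Always choosing an edge that keeps \<open>Q\<close> forced preserves forcing until
  \<open>Q\<close> occurs; by \<open>forces_length\<close> this cannot last beyond round
  \<open>T\<close>.\<close>

lemma strategy_of_forces:
  assumes "infinite V" and "forces V Q []" and bound: "\<And>h. Q h \<Longrightarrow> length h \<le> T"
  obtains \<beta> where "builder_strategy V \<beta>" "\<And>\<pi>. \<exists>t\<le>T. Q (play \<beta> \<pi> t)"
proof -
  define good where "good h e \<longleftrightarrow> legal_edge V h e \<and> (\<forall>c. forces V Q (h @ [(e, c)]))" for h e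
  \<comment> \<open>The fallback choice covers positions without a forcing edge, since a strategy
    must answer every legal position.\<close>
  define \<beta> where "\<beta> h = (if \<exists>e. good h e then SOME e. good h e else SOME e. legal_edge V h e)" for h
  have good: "good h (\<beta> h)" if "good h e" for h e
    using that someI[of "good h" e] unfolding \<beta>_def by auto
  have "legal_edge V h (\<beta> h)" if h: "legal_position V h" for h
  proof (cases "\<exists>e. good h e")
    case True
    then show ?thesis using good unfolding good_def by blast
  next
    case False
    obtain u where u: "u \<in> V" using fresh_vertex[OF assms(1) h, of "{}"] by blast
    obtain x where "x \<in> V" "x \<noteq> u" "x \<notin> \<Union>(fst ` set h)"
      using fresh_vertex[OF assms(1) h, of "{u}"] by blast
    then have "legal_edge V h {u, x}" using u legal_edge_fresh by metis
    then show ?thesis using False unfolding \<beta>_def by (auto intro: someI)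
  qed
  then have strategy: "builder_strategy V \<beta>" by (simp add: builder_strategy_def)
  have "\<exists>t\<le>T. Q (play \<beta> \<pi> t)" for \<pi>
  proof (rule ccontr)
    assume none: "\<not> (\<exists>t\<le>T. Q (play \<beta> \<pi> t))"
    have "forces V Q (play \<beta> \<pi> t)" if "t \<le> Suc T" for t
      using that
    proof (induction t)
      case 0
      then show ?case using assms(2) by simp
    next
      case (Suc t)
      then have "forces V Q (play \<beta> \<pi> t)" "\<not> Q (play \<beta> \<pi> t)" using none by auto
      then obtain e where "good (play \<beta> \<pi> t) e"
        unfolding good_def by (auto elim: forces.cases)
      then have "good (play \<beta> \<pi> t) (\<beta> (play \<beta> \<pi> t))" by (rule good)
      then show ?case by (simp add: good_def Let_def)
    qed
    from forces_length[OF this[of "Suc T"] bound] show False by (simp del: play.simps)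
  qed
  with strategy show thesis using that by blast
qed

section \<open>Paths and outcomes\<close>

lemma mono_path_iff_successively:
  "mono_path h c p \<longleftrightarrow>
     p \<noteq> [] \<and> distinct p \<and> successively (\<lambda>x y. ({x, y}, c) \<in> set h) p"
  by (auto simp: mono_path_def successively_conv_nth)

lemma mono_path_mono: "mono_path h c p \<Longrightarrow> set h \<subseteq> set h' \<Longrightarrow> mono_path h' c p"
  unfolding mono_path_def by blast

lemma mono_path_rev: "mono_path h c p \<Longrightarrow> mono_path h c (rev p)"
  by (simp add: mono_path_iff_successively insert_commute)

lemma mono_path_Cons:
  "mono_path h c p \<Longrightarrow> x \<notin> set p \<Longrightarrow> ({hd p, x}, c) \<in> set h \<Longrightarrow> mono_path h c (x # p)"
  by (simp add: mono_path_iff_successively successively_Cons insert_commute)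

text \<open>A one-vertex path has no edge and may lie outside \<open>V\<close>; with two vertices
  the first edge places its end in \<open>V\<close>.\<close>

lemma hd_mono_path_in:
  assumes "legal_position V h" "mono_path h c p" "2 \<le> length p"
  shows "hd p \<in> V"
proof -
  have "({p ! 0, p ! Suc 0}, c) \<in> set h"
    using assms unfolding mono_path_def by auto
  then have "p ! 0 \<in> V"
    using assms(1) by (metis insertCI legal_position_edge insert_iff empty_iff)
  then show ?thesis using assms(3) by (cases p) auto
qed

lemma last_mono_path_in:
  assumes "legal_position V h" "mono_path h c p" "2 \<le> length p"
  shows "last p \<in> V"
  using hd_mono_path_in[OF assms(1) mono_path_rev[OF assms(2)]] assms(3) by (simp add: hd_rev)

lemma mono_P3_of_touching:
  assumes legal: "legal_position V h" "legal_edge V h {x, y}"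
    and e: "(e, c) \<in> set h" "x \<in> e"
  shows "contains_mono_path (h @ [({x, y}, c)]) c 3"
proof -
  obtain z where z: "e = {z, x}" "z \<noteq> x"
    using legal_position_edge[OF legal(1) e(1)] e(2) by blast
  \<comment> \<open>Otherwise the new edge would already be on the board.\<close>
  have "z \<noteq> y" using z(1) e legal(2) unfolding legal_edge_def by (force simp: insert_commute)
  moreover have "x \<noteq> y" using legal(2) unfolding legal_edge_def by auto
  ultimately have "mono_path (h @ [({x, y}, c)]) c [z, x, y]"
    using z e(1) by (simp add: mono_path_iff_successively)
  then show ?thesis unfolding contains_mono_path_def by fastforce
qed

text \<open>The invariant of the induction: a path that is not good must be ready a round before the
  deadline \<open>T\<close>, and this spare round later pays for making it good.\<close>

definition outcome :: "nat \<Rightarrow> nat \<Rightarrow> 'v position \<Rightarrow> bool" where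
  "outcome m T h \<longleftrightarrow> length h \<le> T \<and>
     (contains_mono_path h Red 3 \<or> contains_mono_path h Blue 3 \<or>
      (\<exists>p. length p = m \<and> mono_path h Green p \<and> (length h < T \<or> good_green_path h p)))"

lemma outcome_clash:
  assumes "legal_position V h" "legal_edge V h {x, y}" "length h < T"
    and "c \<noteq> Green" "(e, c) \<in> set h" "x \<in> e \<or> y \<in> e"
  shows "outcome m T (h @ [({x, y}, c)])"
proof -
  have "contains_mono_path (h @ [({x, y}, c)]) c 3"
    using assms mono_P3_of_touching[of V h x y e c] mono_P3_of_touching[of V h y x e c]
    by (auto simp: insert_commute)
  then show ?thesis using assms(3,4) by (cases c) (auto simp: outcome_def)
qed

section \<open>Strategy trees\<close>

text \<open>
  In a sketch, \<open>0\<close> and \<open>1\<close> stand for the first and the last vertex of a given green path and the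
  labels from \<open>2\<close> on for fresh vertices; it lists the edges drawn since that path was reached.
  By symmetry of the colours, vertex \<open>0\<close> is assumed to touch an older red edge.
\<close>

type_synonym sketch = "(nat \<times> nat \<times> colour) list"

text \<open>
  The subtrees of \<open>Draw u v r b g\<close> are the continuations after red, blue and green; \<open>Clash\<close> marks a
  colour that would create a monochromatic \<open>P\<^sub>3\<close>. A leaf \<open>Path us vs\<close> names the vertices by which the
  given path has been prolonged at \<open>0\<close> and at \<open>1\<close>, from the inside out.
\<close>

datatype tree = Clash | Path "nat list" "nat list" | Draw nat nat tree tree tree

text \<open>Applies when the two ends together touch both red and blue; each end may contribute one
  colour.\<close>

abbreviation Forced :: "nat \<Rightarrow> nat \<Rightarrow> tree \<Rightarrow> tree" where
  "Forced u v g \<equiv> Draw u v Clash Clash g"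

definition touched :: "sketch \<Rightarrow> colour \<Rightarrow> nat \<Rightarrow> bool" where
  "touched E c v \<longleftrightarrow> v = 0 \<and> c = Red \<or> (\<exists>(x, y, d)\<in>set E. d = c \<and> (v = x \<or> v = y))"

abbreviation green_chain :: "sketch \<Rightarrow> nat list \<Rightarrow> bool" where
  "green_chain E \<equiv> successively (\<lambda>u v. (u, v, Green) \<in> set E \<or> (v, u, Green) \<in> set E)"

text \<open>The budget \<open>R\<close> includes the rounds already spent on \<open>E\<close>; a path with untouched ends must be
  ready one round earlier.\<close>

primrec wins :: "nat \<Rightarrow> nat \<Rightarrow> sketch \<Rightarrow> tree \<Rightarrow> bool" where
  "wins R n E Clash \<longleftrightarrow> False"
| "wins R n E (Path us vs) \<longleftrightarrow>
     length us + length vs = n \<and> distinct (us @ vs) \<and> (\<forall>w\<in>set (us @ vs). 1 < w) \<and>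
     green_chain E (0 # us) \<and> green_chain E (1 # vs) \<and>
     (length E < R \<or>
      length E = R \<and> (\<exists>w\<in>{last (0 # us), last (1 # vs)}. touched E Red w \<or> touched E Blue w))"
| "wins R n E (Draw u v r b g) \<longleftrightarrow>
     length E < R \<and> u \<noteq> v \<and> (1 < u \<or> 1 < v) \<and> (\<forall>(x, y, c)\<in>set E. {x, y} \<noteq> {u, v}) \<and>
     (touched E Red u \<or> touched E Red v \<or> wins R n (E @ [(u, v, Red)]) r) \<and>
     (touched E Blue u \<or> touched E Blue v \<or> wins R n (E @ [(u, v, Blue)]) b) \<and>
     wins R n (E @ [(u, v, Green)]) g"

definition realise :: "(nat \<Rightarrow> 'v) \<Rightarrow> (colour \<Rightarrow> colour) \<Rightarrow> sketch \<Rightarrow> 'v position" where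
  "realise f \<sigma> E = map (\<lambda>(u, v, c). ({f u, f v}, \<sigma> c)) E"

lemma realise_simps [simp]:
  "realise f \<sigma> [] = []"
  "realise f \<sigma> (E @ [(u, v, c)]) = realise f \<sigma> E @ [({f u, f v}, \<sigma> c)]"
  "length (realise f \<sigma> E) = length E"
  by (simp_all add: realise_def)

lemma in_set_realise: "(u, v, c) \<in> set E \<Longrightarrow> ({f u, f v}, \<sigma> c) \<in> set (realise f \<sigma> E)"
  by (force simp: realise_def)

text \<open>Links labels to actual vertices. \<open>\<sigma>\<close> swaps red and blue if the known
  edge at the first vertex is blue, so trees written for red serve both colours.\<close>

locale labelled_path =
  fixes V :: "'v set" and h :: "'v position" and p :: "'v list"
    and f :: "nat \<Rightarrow> 'v" and \<sigma> :: "colour \<Rightarrow> colour"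
  assumes legal: "legal_position V h"
    and path: "mono_path h Green p"
    and inj: "inj f" and range: "range f \<subseteq> V"
    and first: "f 0 = hd p" and last: "f 1 = last p"
    and fresh: "1 < i \<Longrightarrow> f i \<notin> set p \<and> f i \<notin> \<Union>(fst ` set h)"
    and touch: "\<exists>e. f 0 \<in> e \<and> (e, \<sigma> Red) \<in> set h"
    and swap: "\<sigma> = id \<or> \<sigma> = id(Red := Blue, Blue := Red)"
begin

abbreviation board :: "sketch \<Rightarrow> 'v position" where
  "board E \<equiv> h @ realise f \<sigma> E"

lemma swap_Green [simp]: "\<sigma> Green = Green"
  using swap by auto

lemma touched_board:
  assumes "touched E c v"
  obtains e where "(e, \<sigma> c) \<in> set (board E)" "f v \<in> e"
proof -
  consider "v = 0" "c = Red" | x y where "(x, y, c) \<in> set E" "v = x \<or> v = y"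
    using assms unfolding touched_def by blast
  then show thesis
  proof cases
    case 1
    then show thesis using touch that by auto
  next
    case 2
    then show thesis using that[of "{f x, f y}"] in_set_realise[OF 2(1), of f \<sigma>] by auto
  qed
qed

lemma touches_red_blue_board:
  assumes "touched E c v" and "c \<noteq> Green"
  shows "touches_red_blue (board E) (f v)"
proof -
  obtain e where "(e, \<sigma> c) \<in> set (board E)" "f v \<in> e"
    using assms(1) by (rule touched_board)
  moreover have "\<sigma> c = Red \<or> \<sigma> c = Blue" using swap assms(2) by (cases c) auto
  ultimately show ?thesis unfolding touches_red_blue_def by metis
qed

text \<open>A label above \<open>1\<close> denotes a vertex on no edge of \<open>h\<close>, so the
  edge is new to \<open>h\<close>; injectivity of \<open>f\<close> makes it new to the sketch as
  well.\<close>

lemma legal_edge_board: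
  assumes "u \<noteq> v" "1 < u \<or> 1 < v" "\<forall>(x, y, c)\<in>set E. {x, y} \<noteq> {u, v}"
  shows "legal_edge V (board E) {f u, f v}"
proof -
  have "{f u, f v} \<notin> fst ` set h" using fresh assms(2) by blast
  moreover have "{f x, f y} \<noteq> {f u, f v}" if "(x, y, c) \<in> set E" for x y c
    using that assms(3) inj_image_eq_iff[OF inj, of "{x, y}" "{u, v}"] by auto
  then have "{f u, f v} \<notin> fst ` set (realise f \<sigma> E)" by (fastforce simp: realise_def)
  moreover have "f u \<noteq> f v" using assms(1) inj by (simp add: inj_eq)
  moreover have "f u \<in> V" "f v \<in> V" using range by auto
  ultimately show ?thesis unfolding legal_edge_def by auto
qed

lemma successively_board:
  "green_chain E us \<Longrightarrow> successively (\<lambda>x y. ({x, y}, Green) \<in> set (board E)) (map f us)"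
  unfolding successively_map
proof (erule successively_mono)
  fix u v assume "(u, v, Green) \<in> set E \<or> (v, u, Green) \<in> set E"
  then show "({f u, f v}, Green) \<in> set (board E)"
    using in_set_realise[of u v Green E f \<sigma>] in_set_realise[of v u Green E f \<sigma>]
    by (auto simp: insert_commute)
qed

text \<open>Both chains lead away from \<open>p\<close>, hence the one attached at its first vertex
  is reversed.\<close>

lemma mono_path_board:
  assumes "distinct (us @ vs)" "\<forall>w\<in>set (us @ vs). 1 < w"
    and "green_chain E (0 # us)" "green_chain E (1 # vs)"
  shows "mono_path (board E) Green (rev (map f us) @ p @ map f vs)"
proof -
  have p: "p \<noteq> []" "distinct p" "successively (\<lambda>x y. ({x, y}, Green) \<in> set (board E)) p"
    using mono_path_mono[OF path, of "board E"] by (auto simp: mono_path_iff_successively)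
  have chains: "successively (\<lambda>x y. ({x, y}, Green) \<in> set (board E)) (hd p # map f us)"
    "successively (\<lambda>x y. ({x, y}, Green) \<in> set (board E)) (last p # map f vs)"
    using successively_board[OF assms(3)] successively_board[OF assms(4)] first last by simp_all
  have "distinct (map f us)" "distinct (map f vs)" "set (map f us) \<inter> set (map f vs) = {}"
    using assms(1) inj_on_subset[OF inj] by (auto simp: distinct_map inj_eq[OF inj])
  moreover have "set (map f us) \<inter> set p = {}" "set p \<inter> set (map f vs) = {}"
    using assms(2) fresh by auto
  ultimately have "distinct (rev (map f us) @ p @ map f vs)"
    using p(2) by (simp add: Int_Un_distrib)
  with chains show ?thesis
    using p unfolding mono_path_iff_successively
    by (auto simp: successively_append_iff successively_Cons last_rev insert_commute
        simp del: distinct_append set_append set_map)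
qed

text \<open>Induction on the tree: leaves give the green path, a colour already touched at an end
  gives a \<open>P_3\<close>, and any other answer leads into a subtree.\<close>

lemma wins_sound:
  assumes "wins R n E t" and "legal_position V (board E)" and "length h + R \<le> T"
  shows "forces V (outcome (length p + n) T) (board E)"
  using assms(1,2)
proof (induction t arbitrary: E)
  case Clash
  then show ?case by simp
next
  case (Path us vs)
  let ?q = "rev (map f us) @ p @ map f vs"
  have mono: "mono_path (board E) Green ?q"
    using Path.prems(1) by (intro mono_path_board) auto
  have "p \<noteq> []" using path by (simp add: mono_path_def)
  then have ends: "hd ?q = f (last (0 # us))" "last ?q = f (last (1 # vs))"
    using first last by (auto simp: hd_append hd_rev last_map)
  have "length (board E) < T \<or> good_green_path (board E) ?q"
  proof (cases "length E < R")
    case True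
    then show ?thesis using assms(3) by simp
  next
    case False
    then obtain w c where "w \<in> {last (0 # us), last (1 # vs)}" "touched E c w" "c \<noteq> Green"
      using Path.prems(1) by fastforce
    then show ?thesis
      using touches_red_blue_board[of E c w] mono ends unfolding good_green_path_def by fastforce
  qed
  moreover have "length ?q = length p + n" "length (board E) \<le> T"
    using Path.prems(1) assms(3) by auto
  ultimately have "outcome (length p + n) T (board E)"
    using mono unfolding outcome_def by blast
  then show ?case by (rule reached)
next
  case (Draw u v r b g)
  let ?e = "{f u, f v}"
  have edge: "legal_edge V (board E) ?e"
    using Draw.prems(1) by (intro legal_edge_board) auto
  have short: "length (board E) < T" using Draw.prems(1) assms(3) by simp
  have clash: "forces V (outcome (length p + n) T) (board E @ [(?e, \<sigma> c)])"
    if c: "touched E c u \<or> touched E c v" "c \<noteq> Green" for c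
  proof -
    obtain e where "(e, \<sigma> c) \<in> set (board E)" "f u \<in> e \<or> f v \<in> e"
      using c(1) by (blast elim: touched_board)
    moreover have "\<sigma> c \<noteq> Green" using swap c(2) by (cases c) auto
    ultimately show ?thesis
      using outcome_clash[OF Draw.prems(2) edge short] by (blast intro: reached)
  qed
  have next_legal: "legal_position V (board (E @ [(u, v, c)]))" for c
    using Draw.prems(2) edge legal_position_snoc[of V "board E" ?e "\<sigma> c"] by simp
  have "forces V (outcome (length p + n) T) (board E @ [(?e, \<sigma> c)])" for c
  proof (cases c)
    case Red
    then show ?thesis using Draw.prems(1) clash[of Red] Draw.IH(1)[OF _ next_legal] by auto
  next
    case Blue
    then show ?thesis using Draw.prems(1) clash[of Blue] Draw.IH(2)[OF _ next_legal] by auto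
  next
    case Green
    then show ?thesis using Draw.prems(1) Draw.IH(3)[OF _ next_legal[of Green]] by simp
  qed
  \<comment> \<open>The tree branches on sketch colours; as \<open>\<sigma>\<close> is an
    involution, every actual answer of Painter is the image of one.\<close>
  moreover have "\<sigma> (\<sigma> c) = c" for c using swap by (cases c) auto
  ultimately have "forces V (outcome (length p + n) T) (board E @ [(?e, c)])" for c
    by metis
  then show ?case using edge by (blast intro: draw)
qed

end

section \<open>Explicit trees for one to four new vertices, checked by evaluation\<close>

lemma wins_one:
  "wins (1 + 2) 1 [] (
    Draw 0 2 Clash (Forced 0 3 (Path [3] [])) (Path [2] []))"
  by code_simp

text \<open>If \<open>1 2\<close> is blue, then \<open>0\<close> and \<open>2\<close> see both
  colours between them and \<open>0 2\<close> is green. If it is red, \<open>0 2\<close> cannot be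
  red, and blue there completes both colours at \<open>0\<close> and at \<open>2\<close>.\<close>

lemma wins_two:
  "wins (2 + 2) 2 [] (
    Draw 1 2
      (Draw 0 2
        Clash
        (Forced 0 3 (Forced 2 3 (Path [3, 2] [])))
        (Draw 1 3 Clash (Forced 1 4 (Path [2] [4])) (Path [2] [3])))
      (Forced 0 2 (Draw 1 3 (Forced 1 4 (Path [2] [4])) Clash (Path [2] [3])))
      (Draw 0 3 Clash (Forced 0 4 (Path [4] [2])) (Path [3] [2])))"
  by code_simp

lemma wins_three:
  "wins (3 + 2) 3 [] (
    Draw 1 2
      (Draw 1 3
        Clash
        (Forced 0 3 (Forced 1 4 (Forced 2 3 (Path [3, 2] [4]))))
        (Draw 0 4
          Clash
          (Forced 0 2 (Forced 2 4 (Path [2, 4] [3])))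
          (Draw 2 3 Clash (Forced 2 4 (Path [4, 2] [3])) (Path [4] [3, 2]))))
      (Draw 1 3
        (Forced 0 2 (Forced 1 4 (Forced 2 3 (Path [2, 3] [4]))))
        Clash
        (Draw 2 4
          (Forced 2 3 (Forced 2 5 (Path [] [3, 2, 5])))
          Clash
          (Forced 0 2 (Path [2, 4] [3]))))
      (Draw 2 3
        (Draw 0 3
          Clash
          (Forced 0 4 (Forced 3 4 (Path [4, 3] [2])))
          (Draw 2 4 Clash (Forced 2 5 (Path [3] [2, 5])) (Path [3] [2, 4])))
        (Forced 0 3 (Draw 2 4 (Forced 2 5 (Path [3] [2, 5])) Clash (Path [3] [2, 4])))
        (Draw 0 4 Clash (Forced 0 5 (Path [5] [2, 3])) (Path [4] [2, 3]))))"
  by code_simp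

text \<open>The opening edge lies off the path. If green, it is a segment used by every leaf of that
  branch; otherwise both its ends become touched.\<close>

lemma wins_four:
  "wins (4 + 2) 4 [] (
    Draw 2 3
      (Draw 2 4
        Clash
        (Forced 0 4 (Forced 1 2 (Forced 2 5 (Forced 3 4 (Path [4, 3] [2, 5])))))
        (Draw 0 3
          Clash
          (Forced 0 4 (Forced 1 3 (Forced 3 5 (Path [4, 2] [3, 5]))))
          (Draw 2 5
            Clash
            (Forced 1 2 (Forced 3 5 (Path [3, 5] [2, 4])))
            (Draw 3 4 Clash (Forced 3 5 (Path [3, 5, 2, 4] [])) (Path [3, 4, 2, 5] [])))))
      (Forced 0 2
        (Draw 3 4
          (Forced 1 3 (Forced 2 4 (Forced 3 5 (Path [2, 4] [3, 5]))))
          Clash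
          (Draw 2 5
            (Forced 2 4 (Forced 3 5 (Path [2, 4, 3, 5] [])))
            Clash
            (Draw 1 3 (Forced 3 5 (Path [2, 5, 3, 4] [])) Clash (Path [2, 5] [3, 4])))))
      (Draw 1 4
        (Draw 0 4
          Clash
          (Forced 0 2 (Forced 3 4 (Forced 4 5 (Path [2, 3, 4, 5] []))))
          (Draw 1 5
            Clash
            (Forced 1 2 (Forced 4 5 (Path [4, 5] [2, 3])))
            (Draw 2 4 Clash (Forced 3 4 (Path [4, 3, 2] [5])) (Path [4, 2, 3] [5]))))
        (Forced 0 4
          (Draw 1 5
            (Forced 1 2 (Forced 4 5 (Path [4, 5] [2, 3])))
            Clash
            (Draw 2 4 (Forced 3 4 (Path [4, 3, 2] [5])) Clash (Path [4, 2, 3] [5]))))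
        (Draw 2 4
          (Draw 0 3
            Clash
            (Forced 0 5 (Forced 3 4 (Path [5] [4, 3, 2])))
            (Draw 2 5 Clash (Forced 2 6 (Path [3, 2, 6] [4])) (Path [3, 2, 5] [4])))
          (Draw 4 5
            (Forced 2 5 (Forced 3 4 (Path [] [4, 3, 2, 5])))
            Clash
            (Forced 0 2 (Path [2, 3] [4, 5])))
          (Draw 0 5 Clash (Forced 0 6 (Path [6] [4, 2, 3])) (Path [5] [4, 2, 3])))))"
  by code_simp

text \<open>Values below four matter because green answers may supply some of the four vertices
  before an end becomes touched.\<close>

lemma winning_tree:
  assumes "n \<le> 4"
  shows "\<exists>t. wins (n + 2) n [] t"
proof -
  have "wins (0 + 2) 0 [] (Path [] [])" by simp
  moreover consider "n = 0" | "n = 1" | "n = 2" | "n = 3" | "n = 4" using assms by linarith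
  ultimately show ?thesis using wins_one wins_two wins_three wins_four by cases blast+
qed

section \<open>Prolonging green paths\<close>

lemma fresh_labelling:
  assumes "infinite V" "finite A" "a \<in> V" "b \<in> V" "a \<noteq> b" "a \<in> A" "b \<in> A"
  obtains f :: "nat \<Rightarrow> 'v" where "inj f" "range f \<subseteq> V" "f 0 = a" "f 1 = b"
    "\<And>i. 1 < i \<Longrightarrow> f i \<notin> A"
proof -
  have "infinite (V - A)" using assms(1,2) by simp
  then obtain g :: "nat \<Rightarrow> 'v" where g: "inj g" "range g \<subseteq> V - A"
    using infinite_countable_subset by blast
  \<comment> \<open>As \<open>a\<close> and \<open>b\<close> lie in \<open>A\<close> and
    \<open>g\<close> avoids \<open>A\<close>, overwriting two values keeps injectivity.\<close>
  define f where "f i = (if i = 0 then a else if i = 1 then b else g i)" for i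
  have "inj f"
    using g assms(5-7) by (auto simp: f_def inj_on_def image_subset_iff)
  moreover have "range f \<subseteq> V" using g(2) assms(3,4) by (auto simp: f_def)
  moreover have "f i \<notin> A" if "1 < i" for i using g(2) that by (auto simp: f_def)
  ultimately show thesis using that by (simp add: f_def)
qed

lemma forces_from_touched_path:
  fixes V :: "'v set"
  assumes "infinite V" and legal: "legal_position V h"
    and path: "mono_path h Green p" "2 \<le> length p" and touched: "touches_red_blue h (hd p)"
    and "n \<le> 4" and "length h + n + 2 \<le> T"
  shows "forces V (outcome (length p + n) T) h"
proof -
  let ?A = "set p \<union> \<Union>(fst ` set h)"
  have "hd p \<noteq> last p"
    using path by (cases p) (auto simp: mono_path_def)
  moreover have "finite ?A" "hd p \<in> ?A" "last p \<in> ?A"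
    using path finite_vertices[OF legal] by (auto simp: mono_path_def)
  ultimately obtain f :: "nat \<Rightarrow> 'v" where f: "inj f" "range f \<subseteq> V" "f 0 = hd p" "f 1 = last p"
    and fresh: "\<And>i. 1 < i \<Longrightarrow> f i \<notin> ?A"
    using fresh_labelling[OF assms(1) _ hd_mono_path_in[OF legal path]
        last_mono_path_in[OF legal path], of ?A] by blast
  obtain e c where e: "hd p \<in> e" "(e, c) \<in> set h" "c = Red \<or> c = Blue"
    using touched unfolding touches_red_blue_def by blast
  \<comment> \<open>Chosen so that \<open>\<sigma> Red\<close> is the colour \<open>c\<close> seen
    at the first vertex.\<close>
  define \<sigma> where "\<sigma> = (if c = Red then id else id(Red := Blue, Blue := Red))"
  interpret labelled_path V h p f \<sigma>
    using legal path f fresh e by unfold_locales (auto simp: \<sigma>_def)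
  obtain t where "wins (n + 2) n [] t" using winning_tree[OF \<open>n \<le> 4\<close>] by blast
  then show ?thesis using wins_sound[of "n + 2" n "[]" t T] assms(7) legal by simp
qed

text \<open>The budget exceeds that of \<open>forces_from_touched_path\<close> by one round, spent
  on the first edge that is not green, which adds no vertex but touches the end.\<close>

lemma forces_from_path:
  assumes "infinite V" and "legal_position V h"
    and "mono_path h Green p" "2 \<le> length p" and "n \<le> 4" and "length h + n + 3 \<le> T"
  shows "forces V (outcome (length p + n) T) h"
  using assms(2-)
proof (induction n arbitrary: h p)
  case 0
  then show ?case by (intro reached) (auto simp: outcome_def)
next
  case (Suc n)
  obtain x where x: "x \<in> V" "x \<notin> set p" "x \<notin> \<Union>(fst ` set h)"
    using fresh_vertex[OF assms(1) Suc.prems(1), of "set p"] by auto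
  have hd: "hd p \<in> V" "hd p \<in> set p"
    using hd_mono_path_in[OF Suc.prems(1-3)] Suc.prems(3) by (auto intro: hd_in_set)
  have edge: "legal_edge V h {hd p, x}"
    using x hd by (intro legal_edge_fresh) auto
  show ?case
  proof (rule draw[OF edge])
    fix c
    let ?h = "h @ [({hd p, x}, c)]"
    have h: "legal_position V ?h" using Suc.prems(1) edge by simp
    have p: "mono_path ?h Green p" by (rule mono_path_mono[OF Suc.prems(2)]) auto
    show "forces V (outcome (length p + Suc n) T) ?h"
    proof (cases "c = Green")
      case True
      then have "mono_path ?h Green (x # p)" by (intro mono_path_Cons p x) auto
      from Suc.IH[OF h this] show ?thesis using Suc.prems by simp
    next
      case False
      then have "touches_red_blue ?h (hd p)"
        unfolding touches_red_blue_def by (cases c) auto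
      then show ?thesis using Suc.prems by (intro forces_from_touched_path assms(1) h p) auto
    qed
  qed
qed

text \<open>A path finished before \<open>T\<close> leaves at least seven rounds, enough for
  \<open>forces_from_path\<close>; a good one leaves at least six and, reversed if necessary, starts
  at a touched vertex.\<close>

lemma forces_step:
  assumes "infinite V" "legal_position V h" "outcome m T h" "2 \<le> m"
  shows "forces V (outcome (m + 4) (T + 6)) h"
proof -
  consider "contains_mono_path h Red 3 \<or> contains_mono_path h Blue 3"
    | p where "length p = m" "mono_path h Green p" "length h < T"
    | p where "length p = m" "good_green_path h p"
    using assms(3) unfolding outcome_def by blast
  then show ?thesis
  proof cases
    case 1
    then show ?thesis using assms(3) by (intro reached) (auto simp: outcome_def)
  next
    case 2
    then show ?thesis using forces_from_path[OF assms(1,2), of p 4 "T + 6"] assms(4) by auto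
  next
    case 3
    then obtain q where "length q = m" "mono_path h Green q" "touches_red_blue h (hd q)"
      unfolding good_green_path_def by (metis length_rev mono_path_rev hd_rev)
    then show ?thesis
      using forces_from_touched_path[OF assms(1,2), of q 4 "T + 6"] assms(3,4)
      by (auto simp: outcome_def)
  qed
qed

text \<open>Three edges at one vertex cannot avoid both green and a red or blue \<open>P\<^sub>3\<close>.\<close>

lemma forces_green_edge:
  assumes "infinite V"
  shows "forces V (outcome 2 3) []"
proof -
  obtain a where a: "a \<in> V" using fresh_vertex[OF assms, of "[]" "{}"] by auto
  obtain x where x: "x \<in> V" "x \<noteq> a" using fresh_vertex[OF assms, of "[]" "{a}"] by auto
  obtain y where y: "y \<in> V" "y \<notin> {a, x}" using fresh_vertex[OF assms, of "[]" "{a, x}"] by auto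
  obtain z where z: "z \<in> V" "z \<notin> {a, x, y}"
    using fresh_vertex[OF assms, of "[]" "{a, x, y}"] by auto
  have xedge: "legal_edge V [] {a, x}" using a x by (intro legal_edge_fresh) auto
  have yedge: "legal_edge V [({a, x}, c)] {a, y}" for c
    using a y by (intro legal_edge_fresh) auto
  have zedge: "legal_edge V [({a, x}, c), ({a, y}, d)] {a, z}" for c d
    using a z by (intro legal_edge_fresh) auto
  \<comment> \<open>In the third round the green edge must be good, which the earlier edges at
    \<open>a\<close> ensure.\<close>
  have green: "outcome 2 3 (h @ [({a, w}, Green)])"
    if "w \<noteq> a" "length h < 3" "length h < 2 \<or> touches_red_blue h a" for h w
  proof -
    let ?h = "h @ [({a, w}, Green)]"
    have "mono_path ?h Green [a, w]" using that(1) by (simp add: mono_path_iff_successively)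
    moreover have "length ?h < 3 \<or> touches_red_blue ?h a"
      using that(3) by (auto simp: touches_red_blue_def)
    moreover have "length [a, w] = 2" "length ?h \<le> 3" using that(2) by simp_all
    ultimately show ?thesis unfolding outcome_def good_green_path_def by (metis list.sel(1))
  qed
  have third: "outcome 2 3 [({a, x}, c), ({a, y}, d), ({a, z}, e)]"
    if "c \<noteq> Green" "d \<noteq> Green" "c \<noteq> d" for c d e
  proof (cases "e = Green")
    case True
    have "touches_red_blue [({a, x}, c), ({a, y}, d)] a"
      using that by (cases c) (auto simp: touches_red_blue_def)
    then show ?thesis using green[of z "[({a, x}, c), ({a, y}, d)]"] z True by simp
  next
    case False
    then have "e = c \<or> e = d" using that by (cases c; cases d; cases e) auto
    then obtain g where "(g, e) \<in> set [({a, x}, c), ({a, y}, d)]" "a \<in> g" by auto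
    then show ?thesis
      using outcome_clash[OF _ zedge[of c d], of 3 e g 2] False xedge yedge[of c]
        legal_position_snoc[of V "[]"] legal_position_snoc[of V "[({a, x}, c)]"] by simp
  qed
  have second: "forces V (outcome 2 3) [({a, x}, c), ({a, y}, d)]" if "c \<noteq> Green" for c d
  proof -
    consider "d = Green" | "d = c" | "d \<noteq> Green" "c \<noteq> d" by blast
    then show ?thesis
    proof cases
      case 1
      then show ?thesis using green[of y "[({a, x}, c)]"] y by (simp add: reached)
    next
      case 2
      then have "outcome 2 3 [({a, x}, c), ({a, y}, d)]"
        using outcome_clash[OF _ yedge[of c], of 3 c "{a, x}" 2] that xedge
          legal_position_snoc[of V "[]"] by simp
      then show ?thesis by (rule reached)
    next
      case 3
      show ?thesis
      proof (rule draw[OF zedge])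
        show "forces V (outcome 2 3) ([({a, x}, c), ({a, y}, d)] @ [({a, z}, e)])" for e
          using third[OF that 3] by (simp add: reached)
      qed
    qed
  qed
  have first: "forces V (outcome 2 3) [({a, x}, c)]" for c
  proof (cases "c = Green")
    case True
    then show ?thesis using green[of x "[]"] x by (simp add: reached)
  next
    case False
    show ?thesis
    proof (rule draw[OF yedge])
      show "forces V (outcome 2 3) ([({a, x}, c)] @ [({a, y}, d)])" for d
        using second[OF False] by simp
    qed
  qed
  show ?thesis
  proof (rule draw[OF xedge])
    show "forces V (outcome 2 3) ([] @ [({a, x}, c)])" for c using first by simp
  qed
qed

text \<open>The index is shifted by one against the theorem, to avoid subtraction:
  \<open>4 * k - 2\<close> and \<open>6 * k - 3\<close> arise at \<open>k - 1\<close>.\<close>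

lemma forces_outcome:
  assumes "infinite V"
  shows "forces V (outcome (4 * k + 2) (6 * k + 3)) []"
proof (induction k)
  case 0
  then show ?case using forces_green_edge[OF assms] by (simp add: numeral_2_eq_2)
next
  case (Suc k)
  have "forces V (outcome (4 * k + 2 + 4) (6 * k + 3 + 6)) []"
    using Suc by (rule forces_bind) (simp, rule forces_step[OF assms], simp_all)
  then show ?case by (simp add: algebra_simps)
qed

theorem theorem3p10:
  fixes V :: "'v set" and k :: nat
  assumes "infinite V" and "k \<ge> 1"
  shows "\<exists>\<beta>. builder_strategy V \<beta> \<and>
    (\<forall>\<pi>.
      (\<exists>t\<le>6 * k - 3. contains_mono_path (play \<beta> \<pi> t) Red 3
                    \<or> contains_mono_path (play \<beta> \<pi> t) Blue 3)
    \<or> (\<exists>t\<le>6 * k - 4. \<exists>p. bad_green_path (play \<beta> \<pi> t) p \<and> length p = 4 * k - 2)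
    \<or> (\<exists>t\<le>6 * k - 3. \<exists>p. good_green_path (play \<beta> \<pi> t) p \<and> length p = 4 * k - 2))"
proof -
  obtain j where k: "k = Suc j" using assms(2) by (cases k) auto
  obtain \<beta> where \<beta>: "builder_strategy V \<beta>"
    "\<And>\<pi>. \<exists>t\<le>6 * k - 3. outcome (4 * k - 2) (6 * k - 3) (play \<beta> \<pi> t)"
  proof (rule strategy_of_forces[OF assms(1)])
    show "forces V (outcome (4 * k - 2) (6 * k - 3)) []"
      using forces_outcome[OF assms(1), of j] k by (simp add: algebra_simps)
  qed (auto simp: outcome_def)
  show ?thesis
  proof (intro exI[of _ \<beta>] conjI allI \<beta>(1))
    fix \<pi>
    obtain t where t: "t \<le> 6 * k - 3" "outcome (4 * k - 2) (6 * k - 3) (play \<beta> \<pi> t)"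
      using \<beta>(2) by blast
    \<comment> \<open>For a path that is not good, \<open>outcome\<close> gives strict inequality,
      which is the earlier deadline for bad paths.\<close>
    have "t \<le> 6 * k - 4" if "t < 6 * k - 3" using that by simp
    with t show "(\<exists>t\<le>6 * k - 3. contains_mono_path (play \<beta> \<pi> t) Red 3
                    \<or> contains_mono_path (play \<beta> \<pi> t) Blue 3)
    \<or> (\<exists>t\<le>6 * k - 4. \<exists>p. bad_green_path (play \<beta> \<pi> t) p \<and> length p = 4 * k - 2)
    \<or> (\<exists>t\<le>6 * k - 3. \<exists>p. good_green_path (play \<beta> \<pi> t) p \<and> length p = 4 * k - 2)"
      unfolding outcome_def bad_green_path_def length_play by blast
  qed
qed

end
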